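(* The difference $\mathrm{gp}_{\mathrm g}(G)-\mathrm{gp}_{\mathrm g}'(G)$ can be arbitrarily large; that is, for every positive integer $N$ there exists a graph $G$ with $\mathrm{gp}_{\mathrm g}(G)-\mathrm{gp}_{\mathrm g}'(G)\ge N$.
   Context: All graphs are finite, simple and undirected. A set $S\subseteq V(G)$ is in general position if no shortest path of $G$ contains more than two vertices of $S$. In the Builder-Blocker general position game on a graph $G$, two players, Builder and Blocker, alternately choose (mark) an unmarked vertex of $G$ so that at each stage the set of all marked vertices is in general position; the game ends when no further vertex can be selected. Builder aims to make the final set of marked vertices as large as possible, Blocker as small as possible. In the B-game Builder moves first; in the B'-game Blocker moves first. $\mathrm{gp}_{\mathrm g}(G)$ (respectively $\mathrm{gp}_{\mathrm g}'(G)$) is the number of vertices in the final set when the B-game (respectively B'-game) is played optimally by both players. *)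

theory Defs
  imports "Graph_Theory.Graph_Theory"
begin

text \<open>
  Finite simple undirected graphs are the locale \<^locale>\<open>graph\<close>: finite symmetric digraphs
  without loops and without parallel arcs. Connectedness is not assumed.
\<close>

definition shortest_vpath :: "'a list \<Rightarrow> ('a, 'b) pre_digraph \<Rightarrow> bool" where
  "shortest_vpath p G \<longleftrightarrow>
     vpath p G \<and> (\<forall>q. vpath q G \<and> hd q = hd p \<and> last q = last p \<longrightarrow> vwalk_length p \<le> vwalk_length q)"

definition general_position :: "('a, 'b) pre_digraph \<Rightarrow> 'a set \<Rightarrow> bool" where
  "general_position G S \<longleftrightarrow>
     S \<subseteq> verts G \<and> (\<forall>p. shortest_vpath p G \<longrightarrow> card (set p \<inter> S) \<le> 2)"

definition legal_moves :: "('a, 'b) pre_digraph \<Rightarrow> 'a set \<Rightarrow> 'a set" where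
  "legal_moves G S = {v \<in> verts G. v \<notin> S \<and> general_position G (insert v S)}"

datatype player = Builder | Blocker

context fin_digraph
begin

lemma finite_legal_moves [simp]: "finite (legal_moves G S)"
  by (simp add: legal_moves_def)

lemma card_unmarked_less:
  assumes "v \<in> legal_moves G S"
  shows "card (verts G - insert v S) < card (verts G - S)"
  using assms by (intro psubset_card_mono) (auto simp: legal_moves_def)

text \<open>
  \<open>final_size P S\<close> is the number of marked vertices at the end of the game under optimal
  play, continued from the position in which \<open>S\<close> is the set of marked vertices and
  player \<open>P\<close> is to move.
\<close>

function final_size :: "player \<Rightarrow> 'a set \<Rightarrow> nat" where
  "final_size Builder S =
     (if legal_moves G S = {} then card S
      else Max ((\<lambda>v. final_size Blocker (insert v S)) ` legal_moves G S))"
| "final_size Blocker S =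
     (if legal_moves G S = {} then card S
      else Min ((\<lambda>v. final_size Builder (insert v S)) ` legal_moves G S))"
  by pat_completeness auto
termination
  by (relation "measure (\<lambda>(P, S). card (verts G - S))") (auto intro: card_unmarked_less)

declare final_size.simps [simp del]

definition gp_g :: nat where
  "gp_g = final_size Builder {}"

definition gp_g' :: nat where
  "gp_g' = final_size Blocker {}"

end

end

theory Submission
  imports Defs
begin

text \<open>
  The graph is the disjoint union of a complete bipartite graph with sides of size \<open>n = N + 2\<close>
  and one isolated vertex \<open>z\<close>.

  In the complete bipartite part the game is decided by its second move there: a second vertex on
  the side of the first one excludes the whole other side, and the play runs until all
  \<open>n\<close> vertices of the side are marked (\<open>final_size_two_on_one_side\<close>), whereas a vertex on the
  opposite side gives an edge that cannot be extended (\<open>no_legal_moves_after_edge\<close>). So each player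
  wants the opponent to move first there. The isolated vertex lies on no path with another vertex and
  can always be marked, so it is a free waiting move: whoever starts takes it and forces the
  opponent to open the bipartite part. If Builder starts, at least \<open>n + 1\<close> vertices get marked; if
  Blocker starts, at most \<open>3\<close>.

  Only one strategy per game has to be analysed, for the player who starts: a strategy of Builder
  bounds the value from below, and one of Blocker bounds it from above. What makes
  the legality of moves a matter of elementary set reasoning is the description of general position
  in \<open>general_position_H_iff\<close>.
\<close>

section \<open>Bounding the value of the game by strategies\<close>

context fin_digraph
begin

lemma Builder_ge_move:
  assumes "v \<in> legal_moves G S"
  shows "final_size Builder S \<ge> final_size Blocker (insert v S)"
  using assms by (auto simp: final_size.simps(1) intro!: Max_ge)

lemma Blocker_le_move:
  assumes "v \<in> legal_moves G S"
  shows "final_size Blocker S \<le> final_size Builder (insert v S)"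
  using assms by (auto simp: final_size.simps(2) intro!: Min_le)

lemma Builder_le:
  assumes "card S \<le> k"
    and "\<And>v. v \<in> legal_moves G S \<Longrightarrow> final_size Blocker (insert v S) \<le> k"
  shows "final_size Builder S \<le> k"
  using assms by (auto simp: final_size.simps(1))

lemma Blocker_ge:
  assumes "legal_moves G S \<noteq> {}"
    and "\<And>v. v \<in> legal_moves G S \<Longrightarrow> k \<le> final_size Builder (insert v S)"
  shows "k \<le> final_size Blocker S"
  using assms by (auto simp: final_size.simps(2))

lemma final_size_terminal:
  assumes "legal_moves G S = {}"
  shows "final_size P S = card S"
  using assms by (cases P) (simp_all add: final_size.simps)

text \<open>
  For positions in which the strategies no longer matter: every continuation, by either player,
  keeps \<open>I\<close> true and thus ends in a set of at least \<open>k\<close> vertices.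
\<close>

lemma final_size_ge_invariant:
  assumes "I S"
    and step: "\<And>S v. I S \<Longrightarrow> v \<in> legal_moves G S \<Longrightarrow> I (insert v S)"
    and stuck: "\<And>S. I S \<Longrightarrow> legal_moves G S = {} \<Longrightarrow> k \<le> card S"
  shows "k \<le> final_size P S"
  using \<open>I S\<close>
proof (induction P S rule: final_size.induct)
  case (1 S)
  show ?case
  proof (cases "legal_moves G S = {}")
    case True
    then show ?thesis using stuck 1 by (simp add: final_size_terminal)
  next
    case False
    then obtain v where v: "v \<in> legal_moves G S" by blast
    with 1 False step have "k \<le> final_size Blocker (insert v S)" by blast
    then show ?thesis using Builder_ge_move[OF v] by simp
  qed
next
  case (2 S)
  show ?case
  proof (cases "legal_moves G S = {}")
    case True
    then show ?thesis using stuck 2 by (simp add: final_size_terminal)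
  next
    case False
    then show ?thesis using 2 step by (intro Blocker_ge) blast+
  qed
qed

end

section \<open>A complete bipartite graph with an isolated vertex\<close>

text \<open>
  Giving the bipartition as a colouring \<open>side\<close> makes the two sides interchangeable, so that no
  argument has to be repeated for the other side.
\<close>

locale biclique_with_isolated_vertex =
  fixes W :: "'a set" and z :: 'a and side :: "'a \<Rightarrow> bool" and n :: nat
  assumes finite_W: "finite W"
    and z_notin_W: "z \<notin> W"
    and two_le_n: "2 \<le> n"
    and card_side: "card {u \<in> W. side u = c} = n"
begin

definition E :: "('a \<times> 'a) set" where
  "E = {(u, v). u \<in> W \<and> v \<in> W \<and> side u \<noteq> side v}"

definition H :: "('a, 'a \<times> 'a) pre_digraph" where
  "H = \<lparr>verts = insert z W, arcs = E, tail = fst, head = snd\<rparr>"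

lemma verts_H: "verts H = insert z W" by (simp add: H_def)

lemma arcs_ends_H: "arcs_ends H = E"
  by (auto simp: H_def arcs_ends_def arc_to_ends_def image_iff)

lemma finite_E: "finite E"
  by (rule finite_subset[of _ "W \<times> W"]) (auto simp: E_def finite_W)

lemma graph_H: "graph H"
proof (unfold_locales)
  show "symmetric H"
    by (auto simp: symmetric_def arcs_ends_H E_def intro!: symI)
  show "finite (arcs H)" by (simp add: H_def finite_E)
qed (auto simp: H_def E_def finite_W arc_to_ends_def)

sublocale graph H by (rule graph_H)

lemma other_vertex_on_side: "\<exists>w. w \<in> W \<and> w \<noteq> v \<and> side w = c"
proof (rule ccontr)
  assume "\<not> ?thesis"
  then have "{u \<in> W. side u = c} \<subseteq> {v}" by auto
  then have "card {u \<in> W. side u = c} \<le> 1"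
    using card_mono[of "{v}"] by simp
  then show False using card_side[of c] two_le_n by simp
qed

section \<open>General position in this graph\<close>

lemma vwalk_in_W:
  assumes "vwalk p H"
  shows "set p \<subseteq> W \<or> (\<exists>u. p = [u])"
  using assms by (induction rule: vwalk_induct) (auto simp: arcs_ends_H E_def)

lemma vpath_2I: "(u, v) \<in> E \<Longrightarrow> vpath [u, v] H"
  by (auto simp: vpath_def vwalk_def arcs_ends_H verts_H E_def)

lemma vpath_3I: "(u, v) \<in> E \<Longrightarrow> (v, w) \<in> E \<Longrightarrow> u \<noteq> w \<Longrightarrow> vpath [u, v, w] H"
  by (auto simp: vpath_def vwalk_def arcs_ends_H verts_H E_def)

text \<open>
  Both components have diameter at most 2: an edge joins vertices on different sides, and any
  vertex of the other side is a common neighbour of two vertices on the same side.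
\<close>

lemma shortest_vpath_length_le:
  assumes "shortest_vpath p H"
  shows "length p \<le> 3"
proof (cases "set p \<subseteq> W \<and> hd p \<noteq> last p")
  case True
  have "vpath p H" and
    short: "\<And>q. vpath q H \<Longrightarrow> hd q = hd p \<Longrightarrow> last q = last p \<Longrightarrow> vwalk_length p \<le> vwalk_length q"
    using assms by (auto simp: shortest_vpath_def)
  then have "p \<noteq> []" by (auto simp: vpath_def vwalk_def)
  with True have ends: "hd p \<in> W" "last p \<in> W" by auto
  show ?thesis
  proof (cases "side (hd p) = side (last p)")
    case False
    then have "(hd p, last p) \<in> E" using ends by (simp add: E_def)
    from short[OF vpath_2I[OF this]] show ?thesis by simp
  next
    case same: True
    obtain w where "w \<in> W" "side w = (\<not> side (hd p))"
      using other_vertex_on_side by blast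
    then have "(hd p, w) \<in> E" "(w, last p) \<in> E" using ends same by (auto simp: E_def)
    from short[OF vpath_3I[OF this]] True show ?thesis by simp
  qed
next
  case False
  then have "vwalk p H" "distinct p" "hd p = last p \<or> (\<exists>u. p = [u])"
    using assms vwalk_in_W by (auto simp: shortest_vpath_def vpath_def)
  then show ?thesis by (cases p) (auto split: if_splits)
qed

text \<open>
  A shortest path with three marked vertices consists of exactly these three, so general position
  only forbids a marked vertex with two marked neighbours. The two neighbours lie on the same side
  and are therefore not adjacent, which makes the path through them a shortest one.
\<close>

lemma general_position_H_iff:
  "general_position H S \<longleftrightarrow>
     S \<subseteq> insert z W \<and> (\<forall>a\<in>S. \<forall>b\<in>S. \<forall>c\<in>S. (a, b) \<in> E \<longrightarrow> (b, c) \<in> E \<longrightarrow> a = c)"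
  (is "_ \<longleftrightarrow> _ \<and> ?cherry_free")
proof (intro iffI conjI)
  assume gp: "general_position H S"
  then show "S \<subseteq> insert z W" by (simp add: general_position_def verts_H)
  show ?cherry_free
  proof (intro ballI impI, rule ccontr)
    fix a b c
    assume S: "a \<in> S" "b \<in> S" "c \<in> S" and E: "(a, b) \<in> E" "(b, c) \<in> E" and "a \<noteq> c"
    have "shortest_vpath [a, b, c] H"
      unfolding shortest_vpath_def
    proof (intro conjI allI impI)
      show "vpath [a, b, c] H" using vpath_3I E \<open>a \<noteq> c\<close> by blast
      fix q
      assume q: "vpath q H \<and> hd q = hd [a, b, c] \<and> last q = last [a, b, c]"
      have "\<not> length q \<le> 2"
      proof
        assume "length q \<le> 2"
        moreover have "q \<noteq> []" "hd q = a" "last q = c"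
          using q by (auto simp: vpath_def vwalk_def)
        ultimately have "q = [a, c]"
          using \<open>a \<noteq> c\<close> by (cases q; cases "tl q") auto
        then have "(a, c) \<in> E" using q by (auto simp: vpath_def vwalk_def arcs_ends_H)
        then show False using E by (auto simp: E_def)
      qed
      then show "vwalk_length [a, b, c] \<le> vwalk_length q" by simp
    qed
    with gp have "card (set [a, b, c] \<inter> S) \<le> 2" by (auto simp only: general_position_def)
    moreover have "set [a, b, c] \<inter> S = {a, b, c}" using S by auto
    moreover have "a \<noteq> b" "b \<noteq> c" using E by (auto simp: E_def)
    then have "card {a, b, c} = 3" using \<open>a \<noteq> c\<close> by simp
    ultimately show False by simp
  qed
next
  assume *: "S \<subseteq> insert z W \<and> ?cherry_free"
  show "general_position H S"
    unfolding general_position_def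
  proof (intro conjI allI impI)
    show "S \<subseteq> verts H" using * by (simp add: verts_H)
    fix p
    assume p: "shortest_vpath p H"
    show "card (set p \<inter> S) \<le> 2"
    proof (rule ccontr)
      assume "\<not> ?thesis"
      then have three: "3 \<le> card (set p \<inter> S)" by simp
      moreover have "card (set p \<inter> S) \<le> card (set p)" by (rule card_mono) auto
      moreover have "card (set p) \<le> length p" by (rule card_length)
      ultimately have len: "length p = 3" and "card (set p \<inter> S) = card (set p)"
        using shortest_vpath_length_le[OF p] by simp_all
      then have "set p \<inter> S = set p" by (intro card_subset_eq) auto
      then have "set p \<subseteq> S" by blast
      moreover obtain a b c where abc: "p = [a, b, c]"
        using len by (auto simp: numeral_3_eq_3 length_Suc_conv)
      moreover have "(a, b) \<in> E" "(b, c) \<in> E" "a \<noteq> c"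
        using p abc by (auto simp: shortest_vpath_def vpath_def vwalk_def arcs_ends_H)
      ultimately show False using * by auto
    qed
  qed
qed

section \<open>Forced endings\<close>

lemma legal_moves_H_iff:
  "v \<in> legal_moves H S \<longleftrightarrow> v \<in> insert z W \<and> v \<notin> S \<and> insert v S \<subseteq> insert z W \<and>
     (\<forall>a\<in>insert v S. \<forall>b\<in>insert v S. \<forall>c\<in>insert v S. (a, b) \<in> E \<longrightarrow> (b, c) \<in> E \<longrightarrow> a = c)"
  by (simp add: legal_moves_def general_position_H_iff verts_H)

text \<open>
  A further vertex of \<open>W\<close> is adjacent to one end of the edge \<open>xy\<close>, which would then have two
  marked neighbours.
\<close>

lemma no_legal_moves_after_edge:
  assumes "(x, y) \<in> E"
  shows "legal_moves H {y, x, z} = {}"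
proof -
  have "v \<notin> legal_moves H {y, x, z}" for v
    using assms z_notin_W by (cases "side v = side x") (auto simp: legal_moves_H_iff E_def)
  then show ?thesis by blast
qed

text \<open>
  Two vertices \<open>x\<close>, \<open>y\<close> on one side rule out the whole other side, while all of their own side
  stays available, so the play ends exactly when that side is exhausted, whatever the players do.
\<close>

lemma final_size_two_on_one_side:
  assumes "x \<in> W" "y \<in> W" "x \<noteq> y" "side x = side y"
  shows "n + 1 \<le> final_size P {y, x, z}"
proof (rule final_size_ge_invariant
    [where I = "\<lambda>S. {y, x, z} \<subseteq> S \<and> S \<subseteq> insert z {u \<in> W. side u = side x}"])
  show "{y, x, z} \<subseteq> {y, x, z} \<and> {y, x, z} \<subseteq> insert z {u \<in> W. side u = side x}"
    using assms by auto
next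
  fix S v
  assume S: "{y, x, z} \<subseteq> S \<and> S \<subseteq> insert z {u \<in> W. side u = side x}"
    and v: "v \<in> legal_moves H S"
  have "side v = side x" if "v \<in> W"
  proof (rule ccontr)
    assume "side v \<noteq> side x"
    then have "(x, v) \<in> E" "(v, y) \<in> E" using assms that by (auto simp: E_def)
    then show False using v S \<open>x \<noteq> y\<close> by (auto simp: legal_moves_H_iff)
  qed
  then show "{y, x, z} \<subseteq> insert v S \<and> insert v S \<subseteq> insert z {u \<in> W. side u = side x}"
    using v S by (auto simp: legal_moves_H_iff)
next
  fix S
  assume S: "{y, x, z} \<subseteq> S \<and> S \<subseteq> insert z {u \<in> W. side u = side x}"
    and none: "legal_moves H S = {}"
  have "u \<in> S" if "u \<in> W" "side u = side x" for u
  proof (rule ccontr)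
    assume "u \<notin> S"
    then have "u \<in> legal_moves H S"
      using S that z_notin_W by (auto simp: legal_moves_H_iff E_def)
    then show False using none by simp
  qed
  then have "S = insert z {u \<in> W. side u = side x}" using S by auto
  then show "n + 1 \<le> card S" using finite_W z_notin_W card_side by simp
qed

section \<open>The two games\<close>

lemma z_legal: "z \<in> legal_moves H {}"
  using z_notin_W by (auto simp: legal_moves_H_iff E_def)

text \<open>
  Builder spends the first move on \<open>z\<close>. Blocker has to open a side, and Builder marks a
  second vertex there.
\<close>

lemma gp_g_ge: "n + 1 \<le> gp_g"
proof -
  have "n + 1 \<le> final_size Blocker {z}"
  proof (rule Blocker_ge)
    obtain w where "w \<in> W" using other_vertex_on_side by blast
    then have "w \<in> legal_moves H {z}" using z_notin_W by (auto simp: legal_moves_H_iff E_def)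
    then show "legal_moves H {z} \<noteq> {}" by blast
  next
    fix x
    assume "x \<in> legal_moves H {z}"
    then have x: "x \<in> W" by (auto simp: legal_moves_H_iff)
    obtain y where y: "y \<in> W" "y \<noteq> x" "side y = side x"
      using other_vertex_on_side by blast
    then have "y \<in> legal_moves H {x, z}"
      using x z_notin_W by (auto simp: legal_moves_H_iff E_def)
    from Builder_ge_move[OF this] show "n + 1 \<le> final_size Builder {x, z}"
      using final_size_two_on_one_side[of x y Blocker] x y by simp
  qed
  also have "\<dots> \<le> gp_g" unfolding gp_g_def using Builder_ge_move[OF z_legal] .
  finally show ?thesis .
qed

text \<open>
  Blocker takes \<open>z\<close> instead. Now Builder has to open a side, and Blocker completes an edge.
\<close>

lemma gp_g'_le: "gp_g' \<le> 3"
proof -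
  have "gp_g' \<le> final_size Builder {z}"
    unfolding gp_g'_def using Blocker_le_move[OF z_legal] .
  also have "\<dots> \<le> 3"
  proof (rule Builder_le)
    show "card {z} \<le> 3" by simp
  next
    fix x
    assume "x \<in> legal_moves H {z}"
    then have x: "x \<in> W" by (auto simp: legal_moves_H_iff)
    obtain y where y: "y \<in> W" "side y = (\<not> side x)"
      using other_vertex_on_side by blast
    then have E: "(x, y) \<in> E" using x by (simp add: E_def)
    have "y \<in> legal_moves H {x, z}"
      using x y z_notin_W by (auto simp: legal_moves_H_iff E_def)
    from Blocker_le_move[OF this] have "final_size Blocker {x, z} \<le> card {y, x, z}"
      using final_size_terminal[OF no_legal_moves_after_edge[OF E]] by simp
    also have "\<dots> \<le> 3" by (simp add: card_insert_if)
    finally show "final_size Blocker {x, z} \<le> 3" .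
  qed
  finally show ?thesis .
qed

end

theorem theorem4p2:
  fixes N :: nat
  assumes "N > 0"
  shows "\<exists>G :: (nat, nat \<times> nat) pre_digraph. graph G \<and>
           int (fin_digraph.gp_g G) - int (fin_digraph.gp_g' G) \<ge> int N"
proof -
  \<comment> \<open>The bounds \<open>n + 1\<close> and \<open>3\<close> for the two games then differ by exactly \<open>N\<close>.\<close>
  define n where "n = N + 2"
  have sides: "card {u \<in> {..<2 * n}. (u < n) = c} = n" for c
  proof (cases c)
    case True
    then have "{u \<in> {..<2 * n}. (u < n) = c} = {..<n}" by auto
    then show ?thesis by simp
  next
    case False
    then have "{u \<in> {..<2 * n}. (u < n) = c} = {n..<2 * n}" by auto
    then show ?thesis by simp
  qed
  interpret biclique_with_isolated_vertex "{..<2 * n}" "2 * n" "\<lambda>u. u < n" n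
    by unfold_locales (use sides in \<open>auto simp: n_def\<close>)
  have "int gp_g - int gp_g' \<ge> int N"
    using gp_g_ge gp_g'_le by (simp add: n_def)
  then show ?thesis using graph_H by blast
qed

end
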